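(* Let $\mathbf M=\langle M,\le,\cdot,\backslash,/\rangle$ be a balanced residuated partially ordered semigroup and let $\Omega=\mathcal C_{\mathrm r}(\mathbf M)$ be its residual coherentization. Then $\mathbf M$ is recovered, up to the evident isomorphism, from the following data: (1) the quotient skeleton, i.e. the join-semilattice $(\Omega,\vee)$; (2) the component algebras $\mathbf L_A$ for $A\in\Omega$; (3) the product-shadow maps $\lambda^{A,C}_q:L_A\to L_C$, $\lambda^{A,C}_q(x)=xq$, for $A\le_\Omega C$ and $q\in C$; (4) the residual-shadow maps $\eta^{A,C}_q:L_A\to L_C$, $\eta^{A,C}_q(x)=x/q$, for $A\le_\Omega C$ and $q\in C$. Explicitly, on the disjoint union of the carriers $L_A$ ($A\in\Omega$) define, for $x\in L_A$, $y\in L_B$ and $C=A\vee B$: (i) the product of $x$ and $y$ as $\min\{\lambda^{A,C}_r(x)\cdot_C\lambda^{B,C}_r(y):r\in C\}$, the minimum being taken with respect to $\le_C$ in $\mathbf L_C$; (ii) the order by declaring $x$ below $y$ if and only if there is $q\in C$ with $\lambda^{A,C}_q(x)\le_C\eta^{B,C}_q(y)$; (iii) the residuals as those determined by this order and product: $x\backslash y=\max\{z:xz\le y\}$ and $x/y=\max\{z:zy\le x\}$. Then all these minima and maxima exist, and the map from the disjoint union to $M$ induced by the inclusions $L_A\subseteq M$ is a bijection under which the product, order and residuals so defined agree with those of $\mathbf M$.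
   Context: A residuated partially ordered semigroup is a structure $\mathbf M=\langle M,\le,\cdot,\backslash,/\rangle$ with $\langle M,\le\rangle$ a poset, $\langle M,\cdot\rangle$ a semigroup, and $xy\le z\iff x\le z/y\iff y\le x\backslash z$. An element $p\in M$ is positive if $z\le zp$ and $z\le pz$ for all $z\in M$. $\mathbf M$ is balanced if for every $x\in M$ one has $x\backslash x=x/x$ and this common value is positive; it is then automatically idempotent. Put $\tau(x):=x\backslash x=x/x$. The positive-idempotent skeleton $\operatorname{Sk}(\mathbf M)$ is the set of positive idempotents with the order inherited from $\mathbf M$; it is a join-semilattice in which $u\vee v=uv=vu$. For $A\subseteq S=\operatorname{Sk}(\mathbf M)$ put $L_A:=\{x\in M:\tau(x)\in A\}$. A skeleton partition is a partition of $S$. For $A,B\subseteq S$ put $A\star_\tau B:=\{\tau(xy),\tau(x\backslash y),\tau(x/y): x\in L_A,\ y\in L_B\}$. For a skeleton partition $\Theta$ and $A,B\in\Theta$ put $\operatorname{Out}_\Theta(A,B):=\{C\in\Theta: C\cap(A\star_\tau B)\neq\varnothing\}$; $\Theta$ is $\tau$-residuation-coherent if all sets $\operatorname{Out}_\Theta(A,B)$ are singletons. For a skeleton partition $\Theta$, form the graph on the blocks of $\Theta$ joining distinct blocks $C,D$ whenever there are $A,B\in\Theta$ with $C,D\in\operatorname{Out}_\Theta(A,B)$; $\operatorname{CC}_{\mathrm r}(\Theta)$ is the partition obtained by merging precisely the blocks lying in the same connected component. Let $\Theta_0=\{\{u\}:u\in S\}$, $\Theta_{n+1}=\operatorname{CC}_{\mathrm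 r}(\Theta_n)$, let $\equiv_n$ be the equivalence relation of $\Theta_n$, and let $\mathcal C_{\mathrm r}(\mathbf M)$ be the partition of $S$ into the classes of $\bigcup_{n<\omega}\equiv_n$; it is the finest $\tau$-residuation-coherent skeleton partition. For a $\tau$-residuation-coherent $\Omega$, the operation $A\vee B:=$ the $\Omega$-block of $u\vee v$ (any $u\in A$, $v\in B$) is well defined and makes $\Omega$ a join-semilattice; $A\le_\Omega B$ means $A\vee B=B$. For $A\in\Omega$, $\mathbf L_A=\langle L_A,\le_A,\cdot_A,\backslash_A,/_A\rangle$ is the component algebra with carrier $L_A$ and with the order and operations of $\mathbf M$ restricted to $L_A$ (it is closed under them). For $A\le_\Omega C$, $q\in C$ and $x\in L_A$, the elements $xq$ and $x/q$ lie in $L_C$, so the shadow maps are well defined. *)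

theory Defs
  imports "HOL-Algebra.Lattice" "HOL-Library.FuncSet"
begin

section \<open>Balanced residuated partially ordered semigroups\<close>

text \<open>
  \<open>ldiv M x y\<close> is the left residual written $x \backslash y$ and \<open>rdiv M x y\<close> is the right
  residual written $x / y$. The field \<^const>\<open>eq\<close> inherited from \<^typ>\<open>'a gorder\<close> is forced to
  be equality by the locale \<^locale>\<open>partial_order\<close>.
\<close>

record 'a rposemigroup = "'a gorder" +
  mult :: "'a \<Rightarrow> 'a \<Rightarrow> 'a" (infixl "\<cdot>\<index>" 70)
  ldiv :: "'a \<Rightarrow> 'a \<Rightarrow> 'a"
  rdiv :: "'a \<Rightarrow> 'a \<Rightarrow> 'a"

locale residuated_po_semigroup = partial_order M for M (structure) +
  assumes mult_closed: "\<lbrakk>x \<in> carrier M; y \<in> carrier M\<rbrakk> \<Longrightarrow> x \<cdot> y \<in> carrier M"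
    and ldiv_closed: "\<lbrakk>x \<in> carrier M; y \<in> carrier M\<rbrakk> \<Longrightarrow> ldiv M x y \<in> carrier M"
    and rdiv_closed: "\<lbrakk>x \<in> carrier M; y \<in> carrier M\<rbrakk> \<Longrightarrow> rdiv M x y \<in> carrier M"
    and mult_assoc: "\<lbrakk>x \<in> carrier M; y \<in> carrier M; z \<in> carrier M\<rbrakk>
      \<Longrightarrow> (x \<cdot> y) \<cdot> z = x \<cdot> (y \<cdot> z)"
    and residuation_right: "\<lbrakk>x \<in> carrier M; y \<in> carrier M; z \<in> carrier M\<rbrakk>
      \<Longrightarrow> x \<cdot> y \<sqsubseteq> z \<longleftrightarrow> x \<sqsubseteq> rdiv M z y"
    and residuation_left: "\<lbrakk>x \<in> carrier M; y \<in> carrier M; z \<in> carrier M\<rbrakk>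
      \<Longrightarrow> x \<cdot> y \<sqsubseteq> z \<longleftrightarrow> y \<sqsubseteq> ldiv M x z"

definition positive :: "'a rposemigroup \<Rightarrow> 'a \<Rightarrow> bool" where
  "positive M p \<longleftrightarrow> p \<in> carrier M \<and>
     (\<forall>z\<in>carrier M. z \<sqsubseteq>\<^bsub>M\<^esub> z \<cdot>\<^bsub>M\<^esub> p \<and> z \<sqsubseteq>\<^bsub>M\<^esub> p \<cdot>\<^bsub>M\<^esub> z)"

locale balanced_residuated_po_semigroup = residuated_po_semigroup M for M (structure) +
  assumes balanced: "x \<in> carrier M \<Longrightarrow> ldiv M x x = rdiv M x x"
    and balanced_positive: "x \<in> carrier M \<Longrightarrow> positive M (ldiv M x x)"

text \<open>
  The structure with carrier \<open>X\<close> whose order and operations are those of \<open>M\<close> cut down to \<open>X\<close>;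
  outside \<open>X\<close> the order is false and the operations are \<^const>\<open>undefined\<close>, so that it
  carries no information about the rest of \<open>M\<close>.
\<close>

definition restrict_to :: "'a rposemigroup \<Rightarrow> 'a set \<Rightarrow> 'a rposemigroup" where
  "restrict_to M X =
     \<lparr> carrier = X, eq = (=),
       le = (\<lambda>x y. x \<in> X \<and> y \<in> X \<and> x \<sqsubseteq>\<^bsub>M\<^esub> y),
       mult = (\<lambda>x\<in>X. \<lambda>y\<in>X. x \<cdot>\<^bsub>M\<^esub> y),
       ldiv = (\<lambda>x\<in>X. \<lambda>y\<in>X. ldiv M x y),
       rdiv = (\<lambda>x\<in>X. \<lambda>y\<in>X. rdiv M x y) \<rparr>"

definition is_isomorphism ::
    "('a \<Rightarrow> 'b) \<Rightarrow> 'a rposemigroup \<Rightarrow> 'b rposemigroup \<Rightarrow> bool" where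
  "is_isomorphism h N M \<longleftrightarrow>
     bij_betw h (carrier N) (carrier M) \<and>
     (\<forall>x\<in>carrier N. \<forall>y\<in>carrier N.
        (x \<sqsubseteq>\<^bsub>N\<^esub> y \<longleftrightarrow> h x \<sqsubseteq>\<^bsub>M\<^esub> h y) \<and>
        x \<cdot>\<^bsub>N\<^esub> y \<in> carrier N \<and> h (x \<cdot>\<^bsub>N\<^esub> y) = h x \<cdot>\<^bsub>M\<^esub> h y \<and>
        ldiv N x y \<in> carrier N \<and> h (ldiv N x y) = ldiv M (h x) (h y) \<and>
        rdiv N x y \<in> carrier N \<and> h (rdiv N x y) = rdiv M (h x) (h y))"


section \<open>The skeleton and its residual coherentization\<close>

definition tau :: "'a rposemigroup \<Rightarrow> 'a \<Rightarrow> 'a" where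
  "tau M x = ldiv M x x"

definition skel :: "'a rposemigroup \<Rightarrow> 'a set" where
  "skel M = {p \<in> carrier M. positive M p \<and> p \<cdot>\<^bsub>M\<^esub> p = p}"

definition skel_order :: "'a rposemigroup \<Rightarrow> 'a gorder" where
  "skel_order M = \<lparr> carrier = skel M, eq = (=), le = le M \<rparr>"

definition layer :: "'a rposemigroup \<Rightarrow> 'a set \<Rightarrow> 'a set" where
  "layer M A = {x \<in> carrier M. tau M x \<in> A}"

definition tau_star :: "'a rposemigroup \<Rightarrow> 'a set \<Rightarrow> 'a set \<Rightarrow> 'a set" where
  "tau_star M A B = (\<Union>x\<in>layer M A. \<Union>y\<in>layer M B.
     {tau M (x \<cdot>\<^bsub>M\<^esub> y), tau M (ldiv M x y), tau M (rdiv M x y)})"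

definition Out :: "'a rposemigroup \<Rightarrow> 'a set set \<Rightarrow> 'a set \<Rightarrow> 'a set \<Rightarrow> 'a set set" where
  "Out M \<Theta> A B = {C \<in> \<Theta>. C \<inter> tau_star M A B \<noteq> {}}"

definition out_graph :: "'a rposemigroup \<Rightarrow> 'a set set \<Rightarrow> ('a set \<times> 'a set) set" where
  "out_graph M \<Theta> = {(C, D). C \<noteq> D \<and> (\<exists>A\<in>\<Theta>. \<exists>B\<in>\<Theta>. C \<in> Out M \<Theta> A B \<and> D \<in> Out M \<Theta> A B)}"

text \<open>
  \<^const>\<open>out_graph\<close> is symmetric, so reachability along its edges is lying in the same
  connected component.
\<close>

definition CC :: "'a rposemigroup \<Rightarrow> 'a set set \<Rightarrow> 'a set set" where
  "CC M \<Theta> = {\<Union>{D \<in> \<Theta>. (C, D) \<in> (out_graph M \<Theta>)\<^sup>*} | C. C \<in> \<Theta>}"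

primrec stage :: "'a rposemigroup \<Rightarrow> nat \<Rightarrow> 'a set set" where
  "stage M 0 = {{u} | u. u \<in> skel M}"
| "stage M (Suc n) = CC M (stage M n)"

definition block_rel :: "'a set set \<Rightarrow> ('a \<times> 'a) set" where
  "block_rel \<Theta> = {(u, v). \<exists>C\<in>\<Theta>. u \<in> C \<and> v \<in> C}"

definition coherentization :: "'a rposemigroup \<Rightarrow> 'a set set" where
  "coherentization M = skel M // (\<Union>n. block_rel (stage M n))"

definition block_join :: "'a rposemigroup \<Rightarrow> 'a set set \<Rightarrow> 'a set \<Rightarrow> 'a set \<Rightarrow> 'a set" where
  "block_join M \<Omega> A B =
     (THE C. C \<in> \<Omega> \<and> (\<forall>u\<in>A. \<forall>v\<in>B. u \<squnion>\<^bsub>skel_order M\<^esub> v \<in> C))"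


section \<open>The decomposition data\<close>

text \<open>
  \<open>pshadow D A C q\<close> and \<open>rshadow D A C q\<close> are the product-shadow map $\lambda^{A,C}_q$ and the
  residual-shadow map $\eta^{A,C}_q$. Each block is itself the set of indices \<open>q\<close>
  of the shadow maps into the component that it names.
\<close>

record 'a shadow_data =
  blocks :: "'a set set"
  bjoin :: "'a set \<Rightarrow> 'a set \<Rightarrow> 'a set"
  component :: "'a set \<Rightarrow> 'a rposemigroup"
  pshadow :: "'a set \<Rightarrow> 'a set \<Rightarrow> 'a \<Rightarrow> 'a \<Rightarrow> 'a"
  rshadow :: "'a set \<Rightarrow> 'a set \<Rightarrow> 'a \<Rightarrow> 'a \<Rightarrow> 'a"

text \<open>
  All functions are restricted to their mathematical domains; in particular a shadow map is
  given only for \<open>A \<le> C\<close> (that is, \<open>A \<or> C = C\<close>), \<open>q \<in> C\<close> and arguments in the layer of \<open>A\<close>.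
\<close>

definition shadow_map ::
    "'a rposemigroup \<Rightarrow> 'a set set \<Rightarrow> ('a \<Rightarrow> 'a \<Rightarrow> 'a) \<Rightarrow> 'a set \<Rightarrow> 'a set \<Rightarrow> 'a \<Rightarrow> 'a \<Rightarrow> 'a" where
  "shadow_map M \<Omega> f A C q =
     (if A \<in> \<Omega> \<and> C \<in> \<Omega> \<and> block_join M \<Omega> A C = C \<and> q \<in> C
      then (\<lambda>x\<in>layer M A. f x q) else undefined)"

definition shadow_data_of :: "'a rposemigroup \<Rightarrow> 'a set set \<Rightarrow> 'a shadow_data" where
  "shadow_data_of M \<Omega> =
     \<lparr> blocks = \<Omega>,
       bjoin = (\<lambda>A\<in>\<Omega>. \<lambda>B\<in>\<Omega>. block_join M \<Omega> A B),
       component = (\<lambda>A\<in>\<Omega>. restrict_to M (layer M A)),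
       pshadow = shadow_map M \<Omega> (mult M),
       rshadow = shadow_map M \<Omega> (rdiv M) \<rparr>"


section \<open>Reconstruction from the data alone\<close>

text \<open>
  An element of the disjoint union of the component carriers is a pair \<open>(A, x)\<close> with
  \<open>x\<close> in the carrier of the component at \<open>A\<close>.
\<close>

definition recon_order :: "'a shadow_data \<Rightarrow> ('a set \<times> 'a) gorder" where
  "recon_order D =
     \<lparr> carrier = (SIGMA A:blocks D. carrier (component D A)), eq = (=),
       le = (\<lambda>(A, x) (B, y). let C = bjoin D A B in
         \<exists>q\<in>C. pshadow D A C q x \<sqsubseteq>\<^bsub>component D C\<^esub> rshadow D B C q y) \<rparr>"

definition recon_products :: "'a shadow_data \<Rightarrow> 'a set \<times> 'a \<Rightarrow> 'a set \<times> 'a \<Rightarrow> 'a set" where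
  "recon_products D = (\<lambda>(A, x) (B, y). let C = bjoin D A B in
     {pshadow D A C r x \<cdot>\<^bsub>component D C\<^esub> pshadow D B C r y | r. r \<in> C})"

definition recon_mult :: "'a shadow_data \<Rightarrow> 'a set \<times> 'a \<Rightarrow> 'a set \<times> 'a \<Rightarrow> 'a set \<times> 'a" where
  "recon_mult D = (\<lambda>(A, x) (B, y). let C = bjoin D A B in
     (C, THE m. least (component D C) m (recon_products D (A, x) (B, y))))"

definition recon_ldiv_set ::
    "'a shadow_data \<Rightarrow> 'a set \<times> 'a \<Rightarrow> 'a set \<times> 'a \<Rightarrow> ('a set \<times> 'a) set" where
  "recon_ldiv_set D a b =
     {c \<in> carrier (recon_order D). recon_mult D a c \<sqsubseteq>\<^bsub>recon_order D\<^esub> b}"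

definition recon_rdiv_set ::
    "'a shadow_data \<Rightarrow> 'a set \<times> 'a \<Rightarrow> 'a set \<times> 'a \<Rightarrow> ('a set \<times> 'a) set" where
  "recon_rdiv_set D a b =
     {c \<in> carrier (recon_order D). recon_mult D c b \<sqsubseteq>\<^bsub>recon_order D\<^esub> a}"

definition reconstruct :: "'a shadow_data \<Rightarrow> ('a set \<times> 'a) rposemigroup" where
  "reconstruct D =
     \<lparr> carrier = carrier (recon_order D), eq = (=), le = le (recon_order D),
       mult = recon_mult D,
       ldiv = (\<lambda>a b. THE m. greatest (recon_order D) m (recon_ldiv_set D a b)),
       rdiv = (\<lambda>a b. THE m. greatest (recon_order D) m (recon_rdiv_set D a b)) \<rparr>"

end

theory Submission
  imports Defs "HOL-Library.Disjoint_Sets"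
begin

text \<open>
  Blocks of \<open>\<Theta>\<^sub>n\<close> met by a common \<open>A \<star>\<^sub>\<tau> B\<close> are merged in \<open>\<Theta>\<^sub>n\<^sub>+\<^sub>1\<close>, so in the
  union \<open>\<equiv>\<close> of the stages the class of \<open>\<tau>(xy)\<close>, \<open>\<tau>(x\y)\<close> and \<open>\<tau>(x/y)\<close> depends only on the classes of \<open>\<tau>(x)\<close> and \<open>\<tau>(y)\<close>.
  Evaluating at the positive idempotents themselves identifies it as the class of
  \<open>\<tau>(x)\<tau>(y) = \<tau>(x) \<or> \<tau>(y)\<close>. The minimum defining the product of \<open>x\<close> and \<open>y\<close> is then attained at
  \<open>r = \<tau>(xy)\<close>, which lies below \<open>\<tau>(xy / y)\<close>, and \<open>x \<le> y\<close> is witnessed by \<open>q = \<tau>(x)\<tau>(y)\<close>.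
\<close>

section \<open>Unions of blocks\<close>

text \<open>Two of these unions with a common point share a block of \<open>P\<close>, because
  distinct blocks are disjoint. Their generating blocks are then related through it, and the unions
  coincide. The relation \<open>r\<close> will be reachability in \<open>out_graph\<close>, which is
  reflexive on all sets.\<close>

lemma partition_on_saturation:
  assumes P: "partition_on S P" and r: "sym r" "trans r" "\<And>C. (C, C) \<in> r"
  shows "partition_on S {\<Union>{D \<in> P. (C, D) \<in> r} | C. C \<in> P}"
proof -
  let ?u = "\<lambda>C. \<Union>{D \<in> P. (C, D) \<in> r}"
  have eq: "?u C = ?u C'" if "(C, C') \<in> r" for C C'
    using that symD[OF r(1)] transD[OF r(2)] by (metis (no_types, lifting))
  have "disjnt (?u C) (?u C')" if "C \<in> P" "C' \<in> P" "?u C \<noteq> ?u C'" for C C'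
  proof (rule ccontr)
    assume "\<not> disjnt (?u C) (?u C')"
    then obtain D D' z where "D \<in> P" "D' \<in> P" "(C, D) \<in> r" "(C', D') \<in> r" "z \<in> D" "z \<in> D'"
      by (auto simp: disjnt_def)
    moreover from this have "D = D'"
      using P by (auto simp: partition_on_def pairwise_def disjnt_def)
    ultimately have "(C, C') \<in> r"
      using symD[OF r(1)] transD[OF r(2)] by metis
    then show False using eq that by blast
  qed
  moreover have "\<Union>{?u C | C. C \<in> P} = S"
    using partition_onD1[OF P] r(3) by fast
  moreover have "{} \<notin> {?u C | C. C \<in> P}"
  proof
    assume "{} \<in> {?u C | C. C \<in> P}"
    then obtain C where "C \<in> P" "?u C = {}" by auto
    then have "C = {}" using r(3)[of C] by blast
    then show False using \<open>C \<in> P\<close> partition_onD3[OF P] by blast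
  qed
  ultimately show ?thesis
    by (intro partition_onI) blast+
qed

lemma sym_out_graph: "sym (out_graph M \<Theta>)"
  by (auto simp: out_graph_def sym_def)

lemma partition_on_CC: "partition_on S P \<Longrightarrow> partition_on S (CC M P)"
  unfolding CC_def
  by (rule partition_on_saturation) (simp_all add: sym_rtrancl sym_out_graph trans_rtrancl)

lemma partition_on_stage: "partition_on (skel M) (stage M n)"
proof (induction n)
  case 0
  show ?case using partition_on_singletons[of "skel M"] by (simp add: Setcompr_eq_image)
next
  case (Suc n)
  then show ?case by (simp add: partition_on_CC)
qed

lemma equiv_block_rel: "partition_on S P \<Longrightarrow> equiv S (block_rel P)"
proof (rule equivI)
  assume P: "partition_on S P"
  show "block_rel P \<subseteq> S \<times> S" "refl_on S (block_rel P)" "sym (block_rel P)"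
    using partition_onD1[OF P] by (auto simp: block_rel_def refl_on_def sym_def)
  show "trans (block_rel P)"
  proof (rule transI)
    fix x y z assume "(x, y) \<in> block_rel P" "(y, z) \<in> block_rel P"
    then obtain C D where C: "C \<in> P" "x \<in> C" "y \<in> C" and D: "D \<in> P" "y \<in> D" "z \<in> D"
      by (auto simp: block_rel_def)
    then have "C = D"
      using partition_onD2[OF P] by (auto simp: disjoint_def)
    then show "(x, z) \<in> block_rel P"
      using C D by (auto simp: block_rel_def)
  qed
qed

lemma block_rel_CC:
  assumes "C \<in> P" "D \<in> P" "(C, D) \<in> (out_graph M P)\<^sup>*" "u \<in> C" "v \<in> D"
  shows "(u, v) \<in> block_rel (CC M P)"
proof -
  let ?U = "\<Union>{D \<in> P. (C, D) \<in> (out_graph M P)\<^sup>*}"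
  have "?U \<in> CC M P"
    using assms(1) by (auto simp: CC_def)
  moreover have "u \<in> ?U" "v \<in> ?U"
    using assms by auto
  ultimately show ?thesis
    unfolding block_rel_def by (intro CollectI case_prodI bexI[of _ ?U] conjI)
qed

text \<open>Merging never splits a block: every block reaches itself along the empty path.\<close>

lemma block_rel_stage_Suc: "block_rel (stage M n) \<subseteq> block_rel (stage M (Suc n))"
  by (auto simp: block_rel_def[of "stage M n"] intro: block_rel_CC)

lemma block_rel_stage_mono: "m \<le> n \<Longrightarrow> block_rel (stage M m) \<subseteq> block_rel (stage M n)"
  by (rule lift_Suc_mono_le[of "\<lambda>n. block_rel (stage M n)"]) (rule block_rel_stage_Suc)

section \<open>The limit of the stages and its coherence\<close>

definition coh :: "'a rposemigroup \<Rightarrow> ('a \<times> 'a) set" where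
  "coh M = (\<Union>n. block_rel (stage M n))"

lemma coherentization_eq: "coherentization M = skel M // coh M"
  by (simp add: coherentization_def coh_def)

text \<open>A union of equivalence relations is in general not transitive. Here the stages increase,
  so two given pairs already lie in a common stage.\<close>

lemma equiv_coh: "equiv (skel M) (coh M)"
proof (rule equivI)
  have E: "equiv (skel M) (block_rel (stage M n))" for n
    by (rule equiv_block_rel[OF partition_on_stage])
  show "coh M \<subseteq> skel M \<times> skel M" "refl_on (skel M) (coh M)" "sym (coh M)"
    using E by (fastforce simp: coh_def equiv_def refl_on_def sym_def)+
  show "trans (coh M)"
  proof (rule transI)
    fix x y z assume "(x, y) \<in> coh M" "(y, z) \<in> coh M"
    then obtain m n where "(x, y) \<in> block_rel (stage M m)" "(y, z) \<in> block_rel (stage M n)"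
      by (auto simp: coh_def)
    then have "(x, y) \<in> block_rel (stage M (max m n))" "(y, z) \<in> block_rel (stage M (max m n))"
      using block_rel_stage_mono[of m "max m n" M] block_rel_stage_mono[of n "max m n" M] by auto
    then show "(x, z) \<in> coh M"
      using E[of "max m n"] unfolding coh_def equiv_def trans_def by blast
  qed
qed

text \<open>This is the coherence of the limit. Both relations between the arguments hold at a
  common stage \<open>k\<close>, and then \<open>c\<close> and \<open>c'\<close> are outputs of the
  same pair of blocks, so stage \<open>Suc k\<close> identifies them. The two outputs may come from
  different operations, for instance a product and a residual. No axioms on \<open>M\<close> are
  available at this point, so membership of the outputs in the skeleton is a hypothesis.\<close>

lemma coh_tau_star:
  assumes "x \<in> carrier M" "x' \<in> carrier M" "y \<in> carrier M" "y' \<in> carrier M"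
    and "(tau M x, tau M x') \<in> coh M" "(tau M y, tau M y') \<in> coh M"
    and c: "c \<in> {tau M (x \<cdot>\<^bsub>M\<^esub> y), tau M (ldiv M x y), tau M (rdiv M x y)}" "c \<in> skel M"
    and c': "c' \<in> {tau M (x' \<cdot>\<^bsub>M\<^esub> y'), tau M (ldiv M x' y'), tau M (rdiv M x' y')}" "c' \<in> skel M"
  shows "(c, c') \<in> coh M"
proof -
  obtain m n where mn: "(tau M x, tau M x') \<in> block_rel (stage M m)"
      "(tau M y, tau M y') \<in> block_rel (stage M n)"
    using assms(5,6) by (auto simp: coh_def)
  define k where "k = max m n"
  have "(tau M x, tau M x') \<in> block_rel (stage M k)" "(tau M y, tau M y') \<in> block_rel (stage M k)"
    using mn block_rel_stage_mono[of m k M] block_rel_stage_mono[of n k M] by (auto simp: k_def)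
  then obtain A B where A: "A \<in> stage M k" "tau M x \<in> A" "tau M x' \<in> A"
    and B: "B \<in> stage M k" "tau M y \<in> B" "tau M y' \<in> B"
    by (auto simp: block_rel_def)
  have star: "c \<in> tau_star M A B" "c' \<in> tau_star M A B"
    unfolding tau_star_def layer_def using assms(1-4) A B c(1) c'(1) by blast+
  obtain C D where C: "C \<in> stage M k" "c \<in> C" and D: "D \<in> stage M k" "c' \<in> D"
    using c(2) c'(2) unfolding partition_onD1[OF partition_on_stage[of M k]] by blast
  \<comment> \<open>The graph has no loops, so the case of equal blocks is separate and is absorbed
    by the reflexive closure.\<close>
  have "C = D \<or> (C, D) \<in> out_graph M (stage M k)"
    unfolding out_graph_def Out_def using A(1) B(1) C D star by blast
  then have "(C, D) \<in> (out_graph M (stage M k))\<^sup>*" by blast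
  then have "(c, c') \<in> block_rel (stage M (Suc k))"
    using block_rel_CC C D by fastforce
  then show ?thesis unfolding coh_def by blast
qed


section \<open>Balanced residuated partially ordered semigroups\<close>

context residuated_po_semigroup
begin

lemma mult_right_mono:
  assumes "x \<sqsubseteq> x'" "x \<in> carrier M" "x' \<in> carrier M" "y \<in> carrier M"
  shows "x \<cdot> y \<sqsubseteq> x' \<cdot> y"
proof -
  have "x' \<sqsubseteq> rdiv M (x' \<cdot> y) y"
    using assms by (simp add: mult_closed flip: residuation_right)
  then have "x \<sqsubseteq> rdiv M (x' \<cdot> y) y"
    using assms by (meson le_trans mult_closed rdiv_closed)
  then show ?thesis using assms by (simp add: mult_closed residuation_right)
qed

lemma mult_left_mono:
  assumes "y \<sqsubseteq> y'" "x \<in> carrier M" "y \<in> carrier M" "y' \<in> carrier M"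
  shows "x \<cdot> y \<sqsubseteq> x \<cdot> y'"
proof -
  have "y' \<sqsubseteq> ldiv M x (x \<cdot> y')"
    using assms by (simp add: mult_closed flip: residuation_left)
  then have "y \<sqsubseteq> ldiv M x (x \<cdot> y')"
    using assms by (meson le_trans mult_closed ldiv_closed)
  then show ?thesis using assms by (simp add: mult_closed residuation_left)
qed

lemma mult_mono:
  assumes "x \<sqsubseteq> x'" "y \<sqsubseteq> y'" "x \<in> carrier M" "x' \<in> carrier M" "y \<in> carrier M" "y' \<in> carrier M"
  shows "x \<cdot> y \<sqsubseteq> x' \<cdot> y'"
  using assms mult_left_mono mult_right_mono by (meson le_trans mult_closed)

lemma rdiv_mult_le: "x \<in> carrier M \<Longrightarrow> y \<in> carrier M \<Longrightarrow> rdiv M x y \<cdot> y \<sqsubseteq> x"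
  by (simp add: rdiv_closed residuation_right)

end

context balanced_residuated_po_semigroup
begin

lemma positive_right: "positive M p \<Longrightarrow> z \<in> carrier M \<Longrightarrow> z \<sqsubseteq> z \<cdot> p"
  and positive_left: "positive M p \<Longrightarrow> z \<in> carrier M \<Longrightarrow> z \<sqsubseteq> p \<cdot> z"
  by (auto simp: positive_def)

lemma skelD:
  assumes "u \<in> skel M"
  shows "u \<in> carrier M" "positive M u" "u \<cdot> u = u"
  using assms by (auto simp: skel_def)

text \<open>By residuation the left side says xqq <= y, and q is idempotent. This removes the
  residual shadow from the reconstructed order.\<close>

lemma mult_skel_le_iff:
  assumes "q \<in> skel M" "x \<in> carrier M" "y \<in> carrier M"
  shows "x \<cdot> q \<sqsubseteq> rdiv M y q \<longleftrightarrow> x \<cdot> q \<sqsubseteq> y"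
  using assms skelD[of q] by (simp add: mult_closed mult_assoc flip: residuation_right)

section \<open>The map \<open>tau\<close> and the multiplication of the skeleton\<close>

lemma tau_closed [simp]: "x \<in> carrier M \<Longrightarrow> tau M x \<in> carrier M"
  by (simp add: tau_def ldiv_closed)

lemma tau_positive: "x \<in> carrier M \<Longrightarrow> positive M (tau M x)"
  by (simp add: tau_def balanced_positive)

text \<open>Balance makes \<open>tau M x\<close> both residuals of x by itself. Hence right and left
  absorption by x are the same condition, which stands in for commutativity later on.\<close>

lemma le_tau_iff:
  assumes "x \<in> carrier M" "z \<in> carrier M"
  shows "z \<sqsubseteq> tau M x \<longleftrightarrow> x \<cdot> z \<sqsubseteq> x" "z \<sqsubseteq> tau M x \<longleftrightarrow> z \<cdot> x \<sqsubseteq> x"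
  using assms residuation_left[of x z x] residuation_right[of z x x]
  by (simp_all add: tau_def balanced)

lemma mult_tau [simp]: "x \<in> carrier M \<Longrightarrow> x \<cdot> tau M x = x"
  and tau_mult [simp]: "x \<in> carrier M \<Longrightarrow> tau M x \<cdot> x = x"
  using positive_right[OF tau_positive] positive_left[OF tau_positive]
  by (auto intro!: le_antisym simp: mult_closed simp flip: le_tau_iff)

lemma tau_skel: "x \<in> carrier M \<Longrightarrow> tau M x \<in> skel M"
  unfolding skel_def
proof (intro CollectI conjI)
  assume x: "x \<in> carrier M"
  have "x \<cdot> (tau M x \<cdot> tau M x) = x"
    using x by (simp flip: mult_assoc)
  then have "tau M x \<cdot> tau M x \<sqsubseteq> tau M x"
    using x by (simp add: le_tau_iff mult_closed)
  then show "tau M x \<cdot> tau M x = tau M x"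
    using x positive_right[OF tau_positive] by (auto intro!: le_antisym simp: mult_closed)
qed (simp_all add: tau_positive)

lemma tau_of_skel [simp]: "u \<in> skel M \<Longrightarrow> tau M u = u"
\<comment> \<open>Idempotence gives u <= \<open>tau M u\<close>. Conversely, positivity of u gives
  \<open>tau M u\<close> <= u times \<open>tau M u\<close>, which is u.\<close>
proof (rule le_antisym)
  assume u: "u \<in> skel M"
  note U = skelD[OF u]
  show "u \<sqsubseteq> tau M u" using U by (simp add: le_tau_iff)
  show "tau M u \<sqsubseteq> u" using positive_left[OF U(2), of "tau M u"] U by simp
qed (simp_all add: skelD)

text \<open>Values of \<open>tau\<close> lie in the skeleton, so it suffices that uv equals t =
  \<open>tau M (u \<cdot> v)\<close>. Both factors are absorbed by uv, hence lie below t, and uv <=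
  tt = t. Positivity of u and v gives t <= (uv)t = uv.\<close>

lemma mult_skel:
  assumes u: "u \<in> skel M" and v: "v \<in> skel M"
  shows "u \<cdot> v \<in> skel M"
proof -
  note U = skelD[OF u] and V = skelD[OF v]
  let ?t = "tau M (u \<cdot> v)"
  have c: "u \<cdot> v \<in> carrier M" using U V by (simp add: mult_closed)
  have "u \<cdot> (u \<cdot> v) = u \<cdot> v" "(u \<cdot> v) \<cdot> v = u \<cdot> v"
    using U V by (simp_all add: mult_assoc) (simp flip: mult_assoc)
  then have "u \<sqsubseteq> ?t" "v \<sqsubseteq> ?t"
    using U V c by (simp_all add: le_tau_iff(2)[of _ u] le_tau_iff(1)[of _ v])
  then have "u \<cdot> v \<sqsubseteq> ?t \<cdot> ?t"
    using U V c by (intro mult_mono) auto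
  then have "u \<cdot> v \<sqsubseteq> ?t" using skelD(3)[OF tau_skel[OF c]] by simp
  moreover have "?t \<sqsubseteq> (u \<cdot> v) \<cdot> ?t"
  proof -
    have "?t \<sqsubseteq> u \<cdot> (v \<cdot> ?t)"
      using U V c positive_left[OF U(2), of "v \<cdot> ?t"] positive_left[OF V(2), of ?t]
      by (meson le_trans mult_closed tau_closed)
    then show ?thesis by (simp only: mult_assoc[OF U(1) V(1) tau_closed[OF c]])
  qed
  ultimately have "?t = u \<cdot> v" using c by (auto intro: le_antisym)
  then show ?thesis using tau_skel[OF c] by simp
qed

lemma join_skel:
  assumes u: "u \<in> skel M" and v: "v \<in> skel M"
  shows "u \<squnion>\<^bsub>skel_order M\<^esub> v = u \<cdot> v"
proof -
  let ?S = "skel_order M"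
  note U = skelD[OF u] and V = skelD[OF v]
  have uv: "u \<cdot> v \<in> skel M" using u v by (rule mult_skel)
  have lub: "least ?S (u \<cdot> v) (Upper ?S {u, v})"
  proof -
    have "u \<cdot> v \<sqsubseteq> w" if "w \<in> skel M" "u \<sqsubseteq> w" "v \<sqsubseteq> w" for w
      using mult_mono[OF that(2,3)] U V skelD[OF that(1)] by simp
    then show ?thesis
      using uv U V u v positive_right[OF V(2) U(1)] positive_left[OF U(2) V(1)]
      by (auto simp: least_def Upper_def skel_order_def)
  qed
  \<comment> \<open>The library join is a choice among least upper bounds, so uniqueness is needed
    to evaluate it.\<close>
  have "x = u \<cdot> v" if x: "least ?S x (Upper ?S {u, v})" for x
  proof (rule le_antisym)
    show "x \<sqsubseteq> u \<cdot> v" "u \<cdot> v \<sqsubseteq> x"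
      using least_le[OF x least_mem[OF lub]] least_le[OF lub least_mem[OF x]]
      by (simp_all add: skel_order_def)
    show "x \<in> carrier M" "u \<cdot> v \<in> carrier M"
      using least_closed[OF x] skelD(1) uv by (simp_all add: skel_order_def)
  qed
  then show ?thesis
    unfolding join_def sup_def by (rule some_equality[where P = "\<lambda>x. least ?S x (Upper ?S {u, v})", OF lub])
qed

section \<open>The product as a minimum of products of shadows\<close>

lemma product_min:
  assumes "x \<in> carrier M" "y \<in> carrier M" "r \<in> skel M"
  shows "x \<cdot> y \<sqsubseteq> (x \<cdot> r) \<cdot> (y \<cdot> r)"
  using assms skelD[of r] by (intro mult_mono) (auto simp: mult_closed positive_right)

lemma product_min_attained:
  assumes x: "x \<in> carrier M" and y: "y \<in> carrier M"
  defines "r \<equiv> tau M (x \<cdot> y)"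
  shows "(x \<cdot> r) \<cdot> (y \<cdot> r) = x \<cdot> y"
proof (rule le_antisym)
  let ?z = "x \<cdot> y"
  let ?w = "rdiv M ?z y"
  have z: "?z \<in> carrier M" using x y by (rule mult_closed)
  then have w: "?w \<in> carrier M" using y by (simp add: rdiv_closed)
  have r: "r \<in> carrier M" using z by (simp add: r_def)
  have "(r \<cdot> ?w) \<cdot> y \<sqsubseteq> r \<cdot> ?z"
    using w r y z by (simp add: mult_assoc mult_left_mono rdiv_mult_le mult_closed)
  then have "r \<cdot> ?w \<sqsubseteq> ?w"
    using w r y z by (simp add: r_def residuation_right[symmetric] mult_closed)
  \<comment> \<open>Here balance is essential: left absorption of r by w, inherited from xy, becomes
    right absorption. This lets r be inserted between x and y, since x <= w.\<close>
  then have "?w \<cdot> r \<sqsubseteq> ?w"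
    using w r by (simp flip: le_tau_iff)
  moreover have "x \<cdot> r \<sqsubseteq> ?w \<cdot> r"
    using x y z w r by (intro mult_right_mono) (auto simp flip: residuation_right)
  ultimately have "x \<cdot> r \<sqsubseteq> ?w"
    using x w r by (meson le_trans mult_closed)
  then have "(x \<cdot> r) \<cdot> y \<sqsubseteq> ?z"
    using x y z r by (simp add: residuation_right mult_closed)
  then have "((x \<cdot> r) \<cdot> y) \<cdot> r \<sqsubseteq> ?z \<cdot> r"
    using x y z r by (simp add: mult_right_mono mult_closed)
  then show "(x \<cdot> r) \<cdot> (y \<cdot> r) \<sqsubseteq> ?z"
    using x y r mult_tau[OF z] mult_assoc[of "x \<cdot> r" y r] by (simp add: mult_closed flip: r_def)
  show "?z \<sqsubseteq> (x \<cdot> r) \<cdot> (y \<cdot> r)"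
    using product_min x y tau_skel[OF z] unfolding r_def by blast
  show "(x \<cdot> r) \<cdot> (y \<cdot> r) \<in> carrier M" "?z \<in> carrier M"
    using x y z r by (simp_all add: mult_closed)
qed


section \<open>Layers over the coherentization\<close>

abbreviation \<Omega> :: "'a set set" where
  "\<Omega> \<equiv> coherentization M"

lemma block_subset: "A \<in> \<Omega> \<Longrightarrow> A \<subseteq> skel M"
  using equiv_coh[of M] by (simp add: coherentization_eq in_quotient_imp_subset)

lemma block_rel_coh: "A \<in> \<Omega> \<Longrightarrow> u \<in> A \<Longrightarrow> v \<in> A \<Longrightarrow> (u, v) \<in> coh M"
  unfolding coherentization_eq by (rule in_quotient_imp_in_rel[OF equiv_coh]) auto

lemma block_closed: "A \<in> \<Omega> \<Longrightarrow> u \<in> A \<Longrightarrow> (u, v) \<in> coh M \<Longrightarrow> v \<in> A"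
  using in_quotient_imp_closed[OF equiv_coh] by (simp add: coherentization_eq)

lemma block_eqI: "A \<in> \<Omega> \<Longrightarrow> B \<in> \<Omega> \<Longrightarrow> u \<in> A \<Longrightarrow> u \<in> B \<Longrightarrow> A = B"
  unfolding coherentization_eq using quotient_disj[OF equiv_coh[of M]] by blast

lemma block_exists: "u \<in> skel M \<Longrightarrow> \<exists>A\<in>\<Omega>. u \<in> A"
  unfolding coherentization_eq using Union_quotient[OF equiv_coh[of M]] by blast

lemma block_nonempty: "A \<in> \<Omega> \<Longrightarrow> \<exists>u. u \<in> A"
  using in_quotient_imp_non_empty[OF equiv_coh] by (auto simp: coherentization_eq)

lemma layer_carrier: "x \<in> layer M A \<Longrightarrow> x \<in> carrier M"
  and layer_tau: "x \<in> layer M A \<Longrightarrow> tau M x \<in> A"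
  by (simp_all add: layer_def)

text \<open>All three outputs are compared with one reference output: the product of the skeleton
  elements u and v, which is its own \<open>tau\<close>.\<close>

lemma tau_coh_mult:
  assumes "x \<in> carrier M" "y \<in> carrier M" "u \<in> skel M" "v \<in> skel M"
    and "(u, tau M x) \<in> coh M" "(v, tau M y) \<in> coh M"
    and "c \<in> {tau M (x \<cdot> y), tau M (ldiv M x y), tau M (rdiv M x y)}"
  shows "(u \<cdot> v, c) \<in> coh M"
proof -
  have c: "c \<in> skel M"
    using assms by (auto intro!: tau_skel mult_closed ldiv_closed rdiv_closed)
  have uv: "u \<cdot> v = tau M (u \<cdot> v)"
    using assms by (simp add: mult_skel)
  show ?thesis
    by (rule coh_tau_star[of u M x v y]) (use assms c uv in \<open>simp_all add: skelD mult_skel\<close>)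
qed

section \<open>Joins of blocks and the layers over them\<close>

lemma block_join_unique:
  assumes A: "A \<in> \<Omega>" and B: "B \<in> \<Omega>"
  shows "\<exists>!C. C \<in> \<Omega> \<and> (\<forall>u\<in>A. \<forall>v\<in>B. u \<squnion>\<^bsub>skel_order M\<^esub> v \<in> C)"
proof -
  obtain a b where ab: "a \<in> A" "b \<in> B"
    using block_nonempty A B by meson
  have S: "u \<in> skel M" if "u \<in> A \<or> u \<in> B" for u
    using that block_subset A B by blast
  obtain C where C: "C \<in> \<Omega>" "a \<cdot> b \<in> C"
    using block_exists mult_skel S ab by blast
  have "u \<squnion>\<^bsub>skel_order M\<^esub> v \<in> C" if "u \<in> A" "v \<in> B" for u v
  proof -
    \<comment> \<open>Coherence is applied to the skeleton elements u and v themselves, which shows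
      that the block of the join does not depend on the representatives.\<close>
    have "(a \<cdot> b, tau M (u \<cdot> v)) \<in> coh M"
      by (rule tau_coh_mult[of u v])
        (use S ab that A B in \<open>auto simp: skelD intro: block_rel_coh\<close>)
    then show ?thesis
      using block_closed C S that by (simp add: join_skel mult_skel)
  qed
  then show ?thesis
    using C ab block_eqI by (intro ex1I[of _ C]) blast+
qed

lemma block_join_closed: "A \<in> \<Omega> \<Longrightarrow> B \<in> \<Omega> \<Longrightarrow> block_join M \<Omega> A B \<in> \<Omega>"
  and mult_in_block_join: "A \<in> \<Omega> \<Longrightarrow> B \<in> \<Omega> \<Longrightarrow> u \<in> A \<Longrightarrow> v \<in> B \<Longrightarrow> u \<cdot> v \<in> block_join M \<Omega> A B"
  using theI'[OF block_join_unique, of A B] block_subset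
  by (auto simp: block_join_def subset_iff simp flip: join_skel)

lemma block_join_eqI:
  assumes "A \<in> \<Omega>" "B \<in> \<Omega>" "C \<in> \<Omega>" "u \<in> A" "v \<in> B" "u \<cdot> v \<in> C"
  shows "block_join M \<Omega> A B = C"
  using block_eqI[OF block_join_closed[OF assms(1,2)] assms(3)]
    mult_in_block_join[OF assms(1,2,4,5)] assms(6) by blast

text \<open>This places A and B below their join, so that the shadow maps from both layers into the
  layer of the join are defined.\<close>

lemma block_join_absorb:
  assumes A: "A \<in> \<Omega>" and B: "B \<in> \<Omega>"
  shows "block_join M \<Omega> A (block_join M \<Omega> A B) = block_join M \<Omega> A B"
    and "block_join M \<Omega> B (block_join M \<Omega> A B) = block_join M \<Omega> A B"
proof -
  obtain a b where ab: "a \<in> A" "b \<in> B"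
    using block_nonempty A B by meson
  then have S: "a \<in> skel M" "b \<in> skel M"
    using block_subset A B by blast+
  note c = skelD[OF S(1)] skelD[OF S(2)]
  have "a \<cdot> (a \<cdot> b) = a \<cdot> b"
    using c by (simp flip: mult_assoc)
  moreover have "b \<cdot> (a \<cdot> b) = a \<cdot> b"
  proof (rule le_antisym)
    \<comment> \<open>Since b <= ab <= \<open>tau M (a \<cdot> b)\<close>, the element ab absorbs b
      on the left as well, and no commutativity is invoked.\<close>
    have "a \<cdot> b \<sqsubseteq> tau M (a \<cdot> b)" "b \<sqsubseteq> a \<cdot> b"
      using S c by (simp_all add: mult_skel mult_closed positive_left)
    then show "b \<cdot> (a \<cdot> b) \<sqsubseteq> a \<cdot> b"
      using S c by (simp add: mult_skel mult_closed flip: le_tau_iff)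
    show "a \<cdot> b \<sqsubseteq> b \<cdot> (a \<cdot> b)"
      using c by (simp add: positive_left mult_closed)
  qed (use c in \<open>simp_all add: mult_closed\<close>)
  ultimately show "block_join M \<Omega> A (block_join M \<Omega> A B) = block_join M \<Omega> A B"
    "block_join M \<Omega> B (block_join M \<Omega> A B) = block_join M \<Omega> A B"
    using ab A B mult_in_block_join[OF A B] block_join_closed[OF A B]
    by (metis block_join_eqI)+
qed

text \<open>With a skeleton element as second argument this gives the codomain of the shadow maps;
  with both layers equal it gives closure of a component.\<close>

lemma layer_block_join:
  assumes A: "A \<in> \<Omega>" and B: "B \<in> \<Omega>" and x: "x \<in> layer M A" and y: "y \<in> layer M B"
    and z: "z \<in> {x \<cdot> y, ldiv M x y, rdiv M x y}"
  shows "z \<in> layer M (block_join M \<Omega> A B)"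
proof -
  note X = layer_carrier[OF x] layer_tau[OF x] and Y = layer_carrier[OF y] layer_tau[OF y]
  have "(tau M x \<cdot> tau M y, tau M z) \<in> coh M"
    by (rule tau_coh_mult[of x y])
      (use X Y A B z in \<open>auto intro: tau_skel block_rel_coh\<close>)
  moreover have "tau M x \<cdot> tau M y \<in> block_join M \<Omega> A B"
    using A B X Y by (intro mult_in_block_join)
  ultimately have "tau M z \<in> block_join M \<Omega> A B"
    using block_closed[OF block_join_closed[OF A B]] by blast
  then show ?thesis
    using X Y z by (auto simp: layer_def mult_closed ldiv_closed rdiv_closed)
qed

lemma skel_layer: "A \<in> \<Omega> \<Longrightarrow> q \<in> A \<Longrightarrow> q \<in> layer M A"
  using block_subset by (auto simp: layer_def skelD subset_iff)

lemma layer_block_exists: "x \<in> carrier M \<Longrightarrow> \<exists>A\<in>\<Omega>. x \<in> layer M A"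
  using block_exists tau_skel by (simp add: layer_def)

lemma layer_block_unique: "A \<in> \<Omega> \<Longrightarrow> B \<in> \<Omega> \<Longrightarrow> x \<in> layer M A \<Longrightarrow> x \<in> layer M B \<Longrightarrow> A = B"
  using block_eqI by (auto simp: layer_def)


section \<open>The reconstruction\<close>

abbreviation \<D> :: "'a shadow_data" where
  "\<D> \<equiv> shadow_data_of M \<Omega>"

lemma bjoin_data: "A \<in> \<Omega> \<Longrightarrow> B \<in> \<Omega> \<Longrightarrow> bjoin \<D> A B = block_join M \<Omega> A B"
  and component_data: "A \<in> \<Omega> \<Longrightarrow> component \<D> A = restrict_to M (layer M A)"
  by (simp_all add: shadow_data_of_def)

lemma shadow_data:
  assumes "A \<in> \<Omega>" "C \<in> \<Omega>" "block_join M \<Omega> A C = C" "q \<in> C" "x \<in> layer M A"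
  shows "pshadow \<D> A C q x = x \<cdot> q" "rshadow \<D> A C q x = rdiv M x q"
    "x \<cdot> q \<in> layer M C" "rdiv M x q \<in> layer M C"
  using assms layer_block_join[OF assms(1,2,5) skel_layer[OF assms(2,4)]]
  by (simp_all add: shadow_data_of_def shadow_map_def)

lemma mem_recon_carrier: "(A, x) \<in> carrier (recon_order \<D>) \<longleftrightarrow> A \<in> \<Omega> \<and> x \<in> layer M A"
  by (auto simp: recon_order_def component_data restrict_to_def) (simp_all add: shadow_data_of_def restrict_to_def)

text \<open>The tag of a pair is redundant: it is the unique block containing \<open>tau\<close> of
  the second component.\<close>

lemma snd_recon_bij: "bij_betw snd (carrier (recon_order \<D>)) (carrier M)"
proof (rule bij_betwI')
  show "snd a \<in> carrier M" if "a \<in> carrier (recon_order \<D>)" for a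
    using that by (cases a) (auto simp: mem_recon_carrier layer_carrier)
  show "snd a = snd b \<longleftrightarrow> a = b" if "a \<in> carrier (recon_order \<D>)" "b \<in> carrier (recon_order \<D>)" for a b
    using that by (cases a; cases b) (auto simp: mem_recon_carrier dest: layer_block_unique)
  show "\<exists>a\<in>carrier (recon_order \<D>). x = snd a" if "x \<in> carrier M" for x
    using layer_block_exists[OF that] mem_recon_carrier by (metis snd_conv)
qed

lemma recon_le_iff:
  assumes "a \<in> carrier (recon_order \<D>)" "b \<in> carrier (recon_order \<D>)"
  shows "a \<sqsubseteq>\<^bsub>recon_order \<D>\<^esub> b \<longleftrightarrow> snd a \<sqsubseteq> snd b"
proof -
  obtain A x B y where ab: "a = (A, x)" "b = (B, y)" by (cases a; cases b)
  with assms have A: "A \<in> \<Omega>" "x \<in> layer M A" and B: "B \<in> \<Omega>" "y \<in> layer M B"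
    by (simp_all add: mem_recon_carrier)
  define C where "C = block_join M \<Omega> A B"
  have C: "C \<in> \<Omega>" "block_join M \<Omega> A C = C" "block_join M \<Omega> B C = C"
    using A B block_join_closed block_join_absorb by (simp_all add: C_def)
  have c: "x \<in> carrier M" "y \<in> carrier M" using A B layer_carrier by blast+
  have "a \<sqsubseteq>\<^bsub>recon_order \<D>\<^esub> b \<longleftrightarrow> (\<exists>q\<in>C. x \<cdot> q \<sqsubseteq> rdiv M y q)"
    using A B C unfolding ab
    by (simp add: recon_order_def Let_def bjoin_data component_data restrict_to_def shadow_data
        flip: C_def)
  also have "\<dots> \<longleftrightarrow> (\<exists>q\<in>C. x \<cdot> q \<sqsubseteq> y)"
    using mult_skel_le_iff c block_subset[OF C(1)] by blast
  also have "\<dots> \<longleftrightarrow> x \<sqsubseteq> y"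
  proof
    assume "\<exists>q\<in>C. x \<cdot> q \<sqsubseteq> y"
    then obtain q where q: "q \<in> skel M" "x \<cdot> q \<sqsubseteq> y" using block_subset[OF C(1)] by blast
    then show "x \<sqsubseteq> y"
      using c skelD[OF q(1)] positive_right[of q x] by (meson le_trans mult_closed)
  next
    \<comment> \<open>The witness must lie in the join block, hence the product of both
      \<open>tau\<close> values. Since x absorbs \<open>tau M x\<close> and y absorbs
      \<open>tau M y\<close>, multiplying x by it stays below y.\<close>
    assume "x \<sqsubseteq> y"
    then have "x \<cdot> tau M y \<sqsubseteq> y" using c mult_right_mono[of x y "tau M y"] by simp
    then have "x \<cdot> (tau M x \<cdot> tau M y) \<sqsubseteq> y" using c by (simp flip: mult_assoc)
    moreover have "tau M x \<cdot> tau M y \<in> C"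
      unfolding C_def using A B layer_tau by (intro mult_in_block_join)
    ultimately show "\<exists>q\<in>C. x \<cdot> q \<sqsubseteq> y" by blast
  qed
  finally show ?thesis by (simp add: ab)
qed

lemma recon_products_least:
  assumes A: "A \<in> \<Omega>" "x \<in> layer M A" and B: "B \<in> \<Omega>" "y \<in> layer M B"
  shows "least (component \<D> (bjoin \<D> A B)) (x \<cdot> y) (recon_products \<D> (A, x) (B, y))"
proof -
  define C where "C = block_join M \<Omega> A B"
  have C: "C \<in> \<Omega>" "block_join M \<Omega> A C = C" "block_join M \<Omega> B C = C"
    using A B block_join_closed block_join_absorb by (simp_all add: C_def)
  have c: "x \<in> carrier M" "y \<in> carrier M" using A B layer_carrier by blast+
  \<comment> \<open>Idempotence of the block join keeps a product of two shadows inside the layer of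
    C.\<close>
  have CC: "block_join M \<Omega> C C = C"
    using block_nonempty[OF C(1)] block_subset[OF C(1)] skelD(3)
    by (metis C(1) block_join_eqI subsetD)
  have xy: "x \<cdot> y \<in> layer M C"
    unfolding C_def using A B by (intro layer_block_join) auto
  have products: "recon_products \<D> (A, x) (B, y) = {(x \<cdot> r) \<cdot> (y \<cdot> r) | r. r \<in> C}"
  proof -
    have "pshadow \<D> A C r x \<cdot>\<^bsub>component \<D> C\<^esub> pshadow \<D> B C r y = (x \<cdot> r) \<cdot> (y \<cdot> r)"
      if "r \<in> C" for r
      using A B C that by (simp add: component_data restrict_to_def shadow_data)
    then show ?thesis
      using A B by (auto simp: recon_products_def Let_def bjoin_data simp flip: C_def) metis
  qed
  have "(x \<cdot> r) \<cdot> (y \<cdot> r) \<in> layer M C" if "r \<in> C" for r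
    using layer_block_join[OF C(1) C(1), of "x \<cdot> r" "y \<cdot> r"] A B C CC that by (simp add: shadow_data)
  moreover have "x \<cdot> y \<sqsubseteq> (x \<cdot> r) \<cdot> (y \<cdot> r)" if "r \<in> C" for r
    using product_min c block_subset[OF C(1)] that by blast
  \<comment> \<open>The minimizing index \<open>tau M (x \<cdot> y)\<close> is admissible because xy
    lies in the layer of C.\<close>
  moreover have "\<exists>r\<in>C. x \<cdot> y = (x \<cdot> r) \<cdot> (y \<cdot> r)"
    using product_min_attained[OF c] layer_tau[OF xy] by metis
  ultimately show ?thesis
    using A B C xy unfolding products
    by (auto simp: least_def bjoin_data component_data restrict_to_def simp flip: C_def)
qed

lemma recon_mult_eq:
  assumes A: "A \<in> \<Omega>" "x \<in> layer M A" and B: "B \<in> \<Omega>" "y \<in> layer M B"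
  shows "recon_mult \<D> (A, x) (B, y) = (block_join M \<Omega> A B, x \<cdot> y)"
proof -
  note L = recon_products_least[OF A B]
  have c: "layer M (block_join M \<Omega> A B) \<subseteq> carrier M" using layer_carrier by blast
  have "m = x \<cdot> y" if "least (component \<D> (bjoin \<D> A B)) m (recon_products \<D> (A, x) (B, y))" for m
    using that L c A B block_join_closed[OF A(1) B(1)]
    by (auto simp: least_def bjoin_data component_data restrict_to_def intro!: le_antisym)
  then have "(THE m. least (component \<D> (bjoin \<D> A B)) m (recon_products \<D> (A, x) (B, y))) = x \<cdot> y"
    using L by blast
  then show ?thesis using A B by (simp add: recon_mult_def Let_def bjoin_data)
qed

lemma recon_mult_iso:
  assumes "a \<in> carrier (recon_order \<D>)" "b \<in> carrier (recon_order \<D>)"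
  shows "recon_mult \<D> a b \<in> carrier (recon_order \<D>)" "snd (recon_mult \<D> a b) = snd a \<cdot> snd b"
  using assms
  by (cases a; cases b; auto simp: mem_recon_carrier recon_mult_eq block_join_closed
      intro: layer_block_join)+

section \<open>The residuals as maxima in the reconstructed order\<close>

lemma recon_greatest_iff:
  assumes "X \<subseteq> carrier (recon_order \<D>)"
    and "m \<in> carrier (recon_order \<D>)"
  shows "greatest (recon_order \<D>) m X \<longleftrightarrow> m \<in> X \<and> (\<forall>c\<in>X. snd c \<sqsubseteq> snd m)"
proof -
  have "c \<sqsubseteq>\<^bsub>recon_order \<D>\<^esub> m \<longleftrightarrow> snd c \<sqsubseteq> snd m" if "c \<in> X" for c
    using assms that by (intro recon_le_iff) auto
  then show ?thesis using assms(1) by (simp add: greatest_def)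
qed

text \<open>Antisymmetry of the reconstructed order is pulled back from \<open>M\<close> along the
  injection \<open>snd\<close>.\<close>

lemma recon_greatest_unique:
  assumes "greatest (recon_order \<D>) m X" "greatest (recon_order \<D>) m' X"
  shows "m = m'"
proof -
  have m: "m \<in> carrier (recon_order \<D>)" "m' \<in> carrier (recon_order \<D>)"
    using assms by auto
  then have "snd m \<sqsubseteq> snd m'" "snd m' \<sqsubseteq> snd m"
    using assms by (auto simp: greatest_def simp flip: recon_le_iff)
  then have "snd m = snd m'"
    using m bij_betwE[OF snd_recon_bij] by (auto intro: le_antisym)
  then show ?thesis
    using m bij_betw_imp_inj_on[OF snd_recon_bij] by (auto dest: inj_onD)
qed

text \<open>Under \<open>snd\<close> the set of candidates is the principal down-set of the left
  residual in \<open>M\<close>, whose preimage is therefore its maximum.\<close>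

lemma recon_ldiv_greatest:
  assumes a: "a \<in> carrier (recon_order \<D>)" and b: "b \<in> carrier (recon_order \<D>)"
  shows "\<exists>m. greatest (recon_order \<D>) m (recon_ldiv_set \<D> a b) \<and> snd m = ldiv M (snd a) (snd b)"
proof -
  have c: "snd d \<in> carrier M" if "d \<in> carrier (recon_order \<D>)" for d
    using that bij_betwE[OF snd_recon_bij] by blast
  have "ldiv M (snd a) (snd b) \<in> snd ` carrier (recon_order \<D>)"
    using ldiv_closed[OF c[OF a] c[OF b]] bij_betw_imp_surj_on[OF snd_recon_bij] by simp
  then obtain m where m: "m \<in> carrier (recon_order \<D>)" "snd m = ldiv M (snd a) (snd b)" by auto
  have "recon_mult \<D> a d \<sqsubseteq>\<^bsub>recon_order \<D>\<^esub> b \<longleftrightarrow> snd d \<sqsubseteq> ldiv M (snd a) (snd b)"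
    if "d \<in> carrier (recon_order \<D>)" for d
    using a b c[OF a] c[OF b] c[OF that] that
    by (simp add: recon_le_iff recon_mult_iso residuation_left)
  then have "recon_ldiv_set \<D> a b = {d \<in> carrier (recon_order \<D>). snd d \<sqsubseteq> ldiv M (snd a) (snd b)}"
    unfolding recon_ldiv_set_def by blast
  then have "greatest (recon_order \<D>) m (recon_ldiv_set \<D> a b)"
    using m ldiv_closed[OF c[OF a] c[OF b]] by (simp add: recon_greatest_iff)
  then show ?thesis using m by blast
qed

lemma recon_rdiv_greatest:
  assumes a: "a \<in> carrier (recon_order \<D>)" and b: "b \<in> carrier (recon_order \<D>)"
  shows "\<exists>m. greatest (recon_order \<D>) m (recon_rdiv_set \<D> a b) \<and> snd m = rdiv M (snd a) (snd b)"
proof -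
  have c: "snd d \<in> carrier M" if "d \<in> carrier (recon_order \<D>)" for d
    using that bij_betwE[OF snd_recon_bij] by blast
  have "rdiv M (snd a) (snd b) \<in> snd ` carrier (recon_order \<D>)"
    using rdiv_closed[OF c[OF a] c[OF b]] bij_betw_imp_surj_on[OF snd_recon_bij] by simp
  then obtain m where m: "m \<in> carrier (recon_order \<D>)" "snd m = rdiv M (snd a) (snd b)" by auto
  have "recon_mult \<D> d b \<sqsubseteq>\<^bsub>recon_order \<D>\<^esub> a \<longleftrightarrow> snd d \<sqsubseteq> rdiv M (snd a) (snd b)"
    if "d \<in> carrier (recon_order \<D>)" for d
    using a b c[OF a] c[OF b] c[OF that] that
    by (simp add: recon_le_iff recon_mult_iso residuation_right)
  then have "recon_rdiv_set \<D> a b = {d \<in> carrier (recon_order \<D>). snd d \<sqsubseteq> rdiv M (snd a) (snd b)}"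
    unfolding recon_rdiv_set_def by blast
  then have "greatest (recon_order \<D>) m (recon_rdiv_set \<D> a b)"
    using m rdiv_closed[OF c[OF a] c[OF b]] by (simp add: recon_greatest_iff)
  then show ?thesis using m by blast
qed

lemma reconstruct_iso: "is_isomorphism snd (reconstruct \<D>) M"
proof -
  \<comment> \<open>Stated for arbitrary X, this evaluates the definite descriptions of both
    residuals.\<close>
  have div: "(THE m. greatest (recon_order \<D>) m X) \<in> carrier (recon_order \<D>) \<and>
      snd (THE m. greatest (recon_order \<D>) m X) = z"
    if "\<exists>m. greatest (recon_order \<D>) m X \<and> snd m = z" for X z
  proof -
    from that obtain m where m: "greatest (recon_order \<D>) m X" "snd m = z" by blast
    then have "(THE m. greatest (recon_order \<D>) m X) = m"
      using recon_greatest_unique by blast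
    then show ?thesis using m by auto
  qed
  show ?thesis
    unfolding is_isomorphism_def reconstruct_def
    by (auto simp: snd_recon_bij recon_le_iff recon_mult_iso
        div[OF recon_ldiv_greatest] div[OF recon_rdiv_greatest])
qed

end

theorem theorem6p4:
  fixes M :: "'a rposemigroup" and \<Omega> :: "'a set set" and D :: "'a shadow_data"
  assumes "balanced_residuated_po_semigroup M"
    and "\<Omega> = coherentization M"
    and "D = shadow_data_of M \<Omega>"
  shows "(\<forall>A\<in>\<Omega>. \<forall>B\<in>\<Omega>. \<forall>x\<in>layer M A. \<forall>y\<in>layer M B.
            (\<exists>m. least (component D (bjoin D A B)) m (recon_products D (A, x) (B, y))) \<and>
            (\<exists>m. greatest (recon_order D) m (recon_ldiv_set D (A, x) (B, y))) \<and>
            (\<exists>m. greatest (recon_order D) m (recon_rdiv_set D (A, x) (B, y)))) \<and>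
         is_isomorphism snd (reconstruct D) M"
proof -
  interpret B: balanced_residuated_po_semigroup M by (rule assms(1))
  show ?thesis
    unfolding assms(3) unfolding assms(2)
    using B.recon_products_least B.recon_ldiv_greatest B.recon_rdiv_greatest B.reconstruct_iso
      B.mem_recon_carrier by meson
qed

end
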